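(* Fix an integer $d\ge 2$. For every $M$-convex set $S\subseteq\Delta_3^d$, $$\operatorname{BR}(\mathcal L_S^+)=\operatorname{Cone}(\mathcal G(S)),$$ i.e. for $w\in\mathbb R^S$ one has $\sup_{f\in\mathcal L_S^+}\prod_{\alpha\in S}c_\alpha(f)^{w_\alpha}<\infty$ if and only if $w$ is a nonnegative linear combination of vectors in $\mathcal G(S)$.
   Context: $\mathbb N=\mathbb Z_{\ge0}$, $\Delta_3^d=\{\alpha\in\mathbb N^3:\alpha_1+\alpha_2+\alpha_3=d\}$, $e_1,e_2,e_3$ is the standard basis of $\mathbb R^3$, $[3]=\{1,2,3\}$, $\alpha!=\alpha_1!\alpha_2!\alpha_3!$, $\mathbf x^\alpha=x_1^{\alpha_1}x_2^{\alpha_2}x_3^{\alpha_3}$. A nonempty $J\subseteq\Delta_3^d$ is $M$-convex if for all $\alpha,\beta\in J$ and every $i$ with $\alpha_i>\beta_i$ there is $j$ with $\alpha_j<\beta_j$ such that $\alpha-e_i+e_j\in J$ and $\beta-e_j+e_i\in J$. Homogeneous polynomials of degree $d\ge2$ with nonnegative coefficients are written $f=\sum_{\alpha\in S}c_\alpha\mathbf x^\alpha/\alpha!$ with $c_\alpha=c_\alpha(f)>0$ for $\alpha\in S=\operatorname{supp}(f)$ and $c_\alpha=0$ otherwise. For $\beta\in\Delta_3^{d-2}$ put $H_\beta(f)=(c_{\beta+e_i+e_j})_{1\le i,j\le3}$ (the Hessian of $\partial^\beta f$). $f$ is Lorentzian if its support is $M$-convex and every symmetric matrix $H_\beta(f)$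 has at most one positive eigenvalue. For $M$-convex $S$, $\mathcal L_S^+$ is the set of Lorentzian $f$ with support exactly $S$, and $\operatorname{BR}(\mathcal L_S^+)=\{w\in\mathbb R^S:\sup_{f\in\mathcal L_S^+}\prod_{\alpha\in S}c_\alpha^{w_\alpha}<\infty\}$. $\operatorname{Cone}(A)$ is the set of finite nonnegative linear combinations of elements of $A$, with $\operatorname{Cone}(\varnothing)=\{0\}$. For $\beta\in\Delta_3^{d-2}$ let $S_\beta=\{e_i+e_j:\beta+e_i+e_j\in S\}\subseteq\Delta_3^2$ (each $S_\beta$ is empty or $M$-convex). Local generators: let $T\subseteq\Delta_3^2$ be empty or $M$-convex, let $\varepsilon_\gamma$ ($\gamma\in T$) be the standard basis of $\mathbb R^T$, and write $ij$ for $e_i+e_j$. The local generators for $T$ are: (a) for every $i$, with $\{i,j,k\}=\{1,2,3\}$, such that $ii,jk,ij,ik\in T$: the vector $\varepsilon_{ii}+\varepsilon_{jk}-\varepsilon_{ij}-\varepsilon_{ik}$; (b) if $T=\{ii,ij,jj\}$ for some $i\neq j$: the vector $\varepsilon_{ii}+\varepsilon_{jj}-2\varepsilon_{ij}$. There are no others. A local generator $g=\sum_{\gamma\in S_\beta}g_\gamma\varepsilon_\gamma$ for $S_\beta$ is extended to $\widetilde g^{\,\beta}=\sum_{\gamma\in S_\beta}g_\gamma\varepsilon_{\beta+\gamma}\in\mathbb R^S$, and $\mathcal G(S)$ is the set of all $\widetilde g^{\,\beta}$ with $\beta\in\Delta_3^{d-2}$ and $g$ a local generator for $S_\beta$. 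*)

theory Defs
  imports "HOL-Analysis.Analysis" "HOL-Computational_Algebra.Polynomial" "HOL-Library.Poly_Mapping"
begin

type_synonym mindex = "nat ^ 3"

text \<open>Trivariate real polynomials as elements of the monoid algebra of \<open>\<nat>\<^sup>3\<close>:
  \<open>Poly_Mapping.lookup f \<alpha>\<close> is the coefficient of \<open>x\<^sup>\<alpha>\<close>, and \<open>Poly_Mapping.keys f\<close> is the
  support of \<open>f\<close>.\<close>

type_synonym poly3 = "mindex \<Rightarrow>\<^sub>0 real"

definition Delta :: "nat \<Rightarrow> mindex set" where
  "Delta d = {\<alpha>. \<alpha> $ 1 + \<alpha> $ 2 + \<alpha> $ 3 = d}"

definition e :: "3 \<Rightarrow> mindex" where
  "e i = axis i 1"

definition mfact :: "mindex \<Rightarrow> real" where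
  "mfact \<alpha> = (\<Prod>i\<in>UNIV. fact (\<alpha> $ i))"

text \<open>The subtractions below never truncate, because \<open>\<alpha> $ i > 0\<close> and \<open>\<beta> $ j > 0\<close>.\<close>

definition M_convex :: "nat \<Rightarrow> mindex set \<Rightarrow> bool" where
  "M_convex d J \<longleftrightarrow> J \<noteq> {} \<and> J \<subseteq> Delta d \<and>
     (\<forall>\<alpha>\<in>J. \<forall>\<beta>\<in>J. \<forall>i. \<alpha> $ i > \<beta> $ i \<longrightarrow>
        (\<exists>j. \<alpha> $ j < \<beta> $ j \<and> \<alpha> - e i + e j \<in> J \<and> \<beta> - e j + e i \<in> J))"

text \<open>The normalised coefficient \<open>c\<^sub>\<alpha>\<close> in \<open>f = (\<Sum>\<alpha>. c\<^sub>\<alpha> x\<^sup>\<alpha> / \<alpha>!)\<close>.\<close>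

definition ncoeff :: "poly3 \<Rightarrow> mindex \<Rightarrow> real" where
  "ncoeff f \<alpha> = mfact \<alpha> * Poly_Mapping.lookup f \<alpha>"

definition hess :: "poly3 \<Rightarrow> mindex \<Rightarrow> real ^ 3 ^ 3" where
  "hess f \<beta> = (\<chi> i j. ncoeff f (\<beta> + e i + e j))"

definition charpoly :: "real ^ 'n ^ 'n \<Rightarrow> real poly" where
  "charpoly A = det (\<chi> i j. (if i = j then [:0, 1:] else 0) - [:A $ i $ j:])"

text \<open>Eigenvalues are counted with multiplicity: \<open>proots\<close> is the multiset of roots.\<close>

definition num_pos_eigenvalues :: "real ^ 'n ^ 'n \<Rightarrow> nat" where
  "num_pos_eigenvalues A = size (filter_mset (\<lambda>x. x > 0) (proots (charpoly A)))"

definition lorentzian :: "nat \<Rightarrow> poly3 \<Rightarrow> bool" where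
  "lorentzian d f \<longleftrightarrow>
     Poly_Mapping.keys f \<subseteq> Delta d \<and> (\<forall>\<alpha>. Poly_Mapping.lookup f \<alpha> \<ge> 0) \<and>
     M_convex d (Poly_Mapping.keys f) \<and>
     (\<forall>\<beta>\<in>Delta (d - 2). num_pos_eigenvalues (hess f \<beta>) \<le> 1)"

definition Lor :: "nat \<Rightarrow> mindex set \<Rightarrow> poly3 set" where
  "Lor d S = {f. lorentzian d f \<and> Poly_Mapping.keys f = S}"

text \<open>For a finite set \<open>S\<close> of multi-indices, \<open>\<real>\<^sup>S\<close> is represented throughout by the real functions on
  \<open>\<nat>\<^sup>3\<close> that vanish outside \<open>S\<close>.\<close>

definition BR :: "nat \<Rightarrow> mindex set \<Rightarrow> (mindex \<Rightarrow> real) set" where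
  "BR d S = {w. (\<forall>\<alpha>. \<alpha> \<notin> S \<longrightarrow> w \<alpha> = 0) \<and>
     bdd_above ((\<lambda>f. \<Prod>\<alpha>\<in>S. ncoeff f \<alpha> powr w \<alpha>) ` Lor d S)}"

definition Cone :: "('a \<Rightarrow> real) set \<Rightarrow> ('a \<Rightarrow> real) set" where
  "Cone A = {w. \<exists>F a. finite F \<and> F \<subseteq> A \<and> (\<forall>g\<in>F. a g \<ge> 0) \<and> w = (\<lambda>\<alpha>. \<Sum>g\<in>F. a g * g \<alpha>)}"

definition eps :: "mindex \<Rightarrow> mindex \<Rightarrow> real" where
  "eps \<gamma> = indicator {\<gamma>}"

definition S_loc :: "mindex set \<Rightarrow> mindex \<Rightarrow> mindex set" where
  "S_loc S \<beta> = {e i + e j | i j. \<beta> + e i + e j \<in> S}"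

definition local_generators :: "mindex set \<Rightarrow> (mindex \<Rightarrow> real) set" where
  "local_generators T =
     {(\<lambda>\<gamma>. eps (e i + e i) \<gamma> + eps (e j + e k) \<gamma> - eps (e i + e j) \<gamma> - eps (e i + e k) \<gamma>) | i j k.
        {i, j, k} = UNIV \<and> {e i + e i, e j + e k, e i + e j, e i + e k} \<subseteq> T} \<union>
     {(\<lambda>\<gamma>. eps (e i + e i) \<gamma> + eps (e j + e j) \<gamma> - 2 * eps (e i + e j) \<gamma>) | i j.
        i \<noteq> j \<and> T = {e i + e i, e i + e j, e j + e j}}"

definition extend :: "mindex set \<Rightarrow> mindex \<Rightarrow> (mindex \<Rightarrow> real) \<Rightarrow> mindex \<Rightarrow> real" where
  "extend S \<beta> g = (\<lambda>\<alpha>. \<Sum>\<gamma>\<in>S_loc S \<beta>. g \<gamma> * eps (\<beta> + \<gamma>) \<alpha>)"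

definition generators :: "nat \<Rightarrow> mindex set \<Rightarrow> (mindex \<Rightarrow> real) set" where
  "generators d S = {extend S \<beta> g | \<beta> g. \<beta> \<in> Delta (d - 2) \<and> g \<in> local_generators (S_loc S \<beta>)}"

end

theory Submission
  imports Defs
begin

text \<open>
  In logarithmic coordinates \<open>y\<^sub>\<alpha> = ln c\<^sub>\<alpha>\<close> the monomial \<open>\<Prod> c\<^sub>\<alpha>\<^bsup>w \<alpha>\<^esup>\<close> becomes the exponential of the
  linear form \<open>\<Sum> w\<^sub>\<alpha> y\<^sub>\<alpha>\<close>, so \<open>BR\<close> consists of the linear forms bounded above on the logarithmic image
  of the Lorentzian polynomials with support \<open>S\<close>. The theorem holds because, up to a bounded error,
  this image is the polyhedral cone on which all generators are nonpositive.

  One inclusion says that every generator is bounded above. For a symmetric nonnegative \<open>3 \<times> 3\<close> matrix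
  with at most one positive eigenvalue, \<open>A\<^sub>i\<^sub>i A\<^sub>j\<^sub>j \<le> A\<^sub>i\<^sub>j\<^sup>2\<close> when \<open>A\<^sub>i\<^sub>j \<noteq> 0\<close>, and
  \<open>A\<^sub>i\<^sub>i A\<^sub>j\<^sub>k \<le> 2 A\<^sub>i\<^sub>j A\<^sub>i\<^sub>k\<close> when \<open>A\<^sub>i\<^sub>j\<close> and \<open>A\<^sub>i\<^sub>k\<close> are positive (\<open>one_positive_eigenvalue_minor_det\<close>,
  \<open>one_positive_eigenvalue_product_le\<close>); applied to the Hessians this bounds each generator by
  \<open>ln 2\<close>, and hence every nonnegative combination.

  For the other inclusion let \<open>x\<close> be a point at which all generators are nonpositive. The polynomials with
  \<open>c\<^sub>\<alpha> = exp (t x\<^sub>\<alpha> - |\<alpha>|\<^sup>2/2)\<close>, where \<open>|\<alpha>|\<close> is the Euclidean norm, are Lorentzian for every \<open>t \<ge> 0\<close>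
  (\<open>Lor_if_generators_nonpos\<close>): the concave correction makes the generators at most \<open>-1\<close>, and this is
  enough for the determinant of every Hessian to be nonnegative and its principal \<open>2 \<times> 2\<close> minors to be
  nonpositive. Letting \<open>t\<close> tend to infinity, any \<open>w\<close> in \<open>BR\<close> must be nonpositive at \<open>x\<close>.
  As this is so for all such \<open>x\<close>, the Farkas lemma \<open>farkas_finite_family\<close> puts \<open>w\<close>
  into the cone.
\<close>

section \<open>Ternary symmetric matrices with at most one positive eigenvalue\<close>

text \<open>
  Since \<open>p\<close> tends to infinity it has a root \<open>l \<ge> \<mu>\<close>; the cofactor of \<open>X - l\<close> has no positive root and is
  therefore positive on the positive axis, so the sign of \<open>p\<close> there is that of \<open>x - l\<close>.
\<close>

lemma monic_one_positive_root_neg: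
  fixes p :: "real poly"
  assumes monic: "lead_coeff p = 1"
    and roots: "size (filter_mset (\<lambda>x. x > 0) (proots p)) \<le> 1"
    and \<mu>: "\<mu> > 0" "poly p \<mu> \<le> 0"
  shows "0 < x \<Longrightarrow> x < \<mu> \<Longrightarrow> poly p x < 0" and "poly p 0 \<le> 0"
proof -
  obtain l where l: "l \<ge> \<mu>" "poly p l = 0"
  proof (cases "poly p \<mu> = 0")
    case False
    obtain N where N: "\<And>x. x \<ge> N \<Longrightarrow> poly p x \<ge> 1"
      using poly_pinfty_gt_lc[of p] monic by auto
    have "poly p (max N (\<mu> + 1)) > 0" using N[of "max N (\<mu> + 1)"] by simp
    with False \<mu> poly_IVT_pos[of \<mu> "max N (\<mu> + 1)" p]
    obtain x where "\<mu> < x" "poly p x = 0" by (force simp: less_max_iff_disj)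
    thus ?thesis using that[of x] by simp
  next
    case True
    thus ?thesis using that[of \<mu>] by simp
  qed
  then obtain r where r: "p = [:-l, 1:] * r"
    by (metis dvdE poly_eq_0_iff_dvd)
  have "p \<noteq> 0" using monic by auto
  hence "r \<noteq> 0" using r by auto
  have lr: "lead_coeff r = 1" using monic unfolding r lead_coeff_mult by simp
  have "proots p = {#l#} + proots r"
    unfolding r using \<open>r \<noteq> 0\<close> by (subst proots_mult) auto
  hence "filter_mset (\<lambda>x. x > 0) (proots r) = {#}"
    using roots l \<mu> by simp
  hence nz: "poly r y \<noteq> 0" if "y > 0" for y
    using that \<open>r \<noteq> 0\<close> by (auto simp: filter_mset_eq_conv)
  obtain N where N: "\<And>x. x \<ge> N \<Longrightarrow> poly r x \<ge> 1"
    using poly_pinfty_gt_lc[of r] lr by auto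
  have large: "poly r (max N (y + 1)) > 0" for y
    using N[of "max N (y + 1)"] by simp
  have pos: "poly r y > 0" if "y > 0" for y
  proof (rule ccontr)
    assume "\<not> poly r y > 0"
    with nz that have "poly r y < 0" by force
    with poly_IVT_pos[of y "max N (y + 1)" r] large[of y]
    obtain x where "y < x" "poly r x = 0" by (force simp: less_max_iff_disj)
    with nz[of x] that show False by simp
  qed
  have pos0: "poly r 0 \<ge> 0"
  proof (rule ccontr)
    assume "\<not> poly r 0 \<ge> 0"
    with poly_IVT_pos[of 0 1 r] pos[of 1] nz show False by auto
  qed
  show "poly p x < 0" if "0 < x" "x < \<mu>"
    using mult_neg_pos[of "x - l" "poly r x"] pos[OF that(1)] that l
    unfolding r by (simp add: algebra_simps)
  show "poly p 0 \<le> 0"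
    using pos0 l \<mu> unfolding r by simp
qed

lemma UNIV_3_cases:
  assumes "{i, j, k} = (UNIV :: 3 set)"
  shows "(i = 1 \<and> j = 2 \<and> k = 3) \<or> (i = 1 \<and> j = 3 \<and> k = 2) \<or> (i = 2 \<and> j = 1 \<and> k = 3) \<or>
         (i = 2 \<and> j = 3 \<and> k = 1) \<or> (i = 3 \<and> j = 1 \<and> k = 2) \<or> (i = 3 \<and> j = 2 \<and> k = 1)"
proof -
  have "card {i, j, k} = 3" using assms by simp
  hence "i \<noteq> j" "i \<noteq> k" "j \<noteq> k"
    by (auto simp: card_insert_if split: if_splits)
  thus ?thesis using exhaust_3[of i] exhaust_3[of j] exhaust_3[of k] by auto
qed

lemma charpoly_3:
  fixes A :: "real^3^3"
  assumes sym: "\<And>a b. A $ a $ b = A $ b $ a" and ijk: "{i, j, k} = (UNIV :: 3 set)"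
  shows "charpoly A =
    [: - (A$i$i * A$j$j * A$k$k + 2 * A$i$j * A$i$k * A$j$k
            - A$i$i * (A$j$k)\<^sup>2 - A$j$j * (A$i$k)\<^sup>2 - A$k$k * (A$i$j)\<^sup>2),
       (A$i$i * A$j$j - (A$i$j)\<^sup>2) + (A$i$i * A$k$k - (A$i$k)\<^sup>2) + (A$j$j * A$k$k - (A$j$k)\<^sup>2),
       - (A$i$i + A$j$j + A$k$k), 1 :]"
proof -
  have s: "A$2$1 = A$1$2" "A$3$1 = A$1$3" "A$3$2 = A$2$3" using sym by auto
  have "charpoly A = 
    [: - (A$1$1 * A$2$2 * A$3$3 + 2 * A$1$2 * A$1$3 * A$2$3
            - A$1$1 * (A$2$3)\<^sup>2 - A$2$2 * (A$1$3)\<^sup>2 - A$3$3 * (A$1$2)\<^sup>2),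
       (A$1$1 * A$2$2 - (A$1$2)\<^sup>2) + (A$1$1 * A$3$3 - (A$1$3)\<^sup>2) + (A$2$2 * A$3$3 - (A$2$3)\<^sup>2),
       - (A$1$1 + A$2$2 + A$3$3), 1 :]"
    unfolding charpoly_def det_3 by (simp add: s algebra_simps power2_eq_square)
  with UNIV_3_cases[OF ijk] s show ?thesis
    by (elim disjE) (simp_all add: algebra_simps)
qed

lemma two_positive_roots_factor:
  fixes p :: "real poly"
  assumes "size (filter_mset (\<lambda>x. x > 0) (proots p)) \<ge> 2"
  obtains x y q where "x > 0" "y > 0" "p = [:-x, 1:] * ([:-y, 1:] * q)"
proof -
  have root: "\<exists>x>0. poly p x = 0 \<and> p \<noteq> 0"
    if "size (filter_mset (\<lambda>x. x > 0) (proots p)) \<ge> 1" for p :: "real poly"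
  proof -
    have "p \<noteq> 0" using that by auto
    moreover have "filter_mset (\<lambda>x. x > 0) (proots p) \<noteq> {#}" using that by force
    then obtain x where "x \<in># filter_mset (\<lambda>x. x > 0) (proots p)"
      by (meson multiset_nonemptyE)
    ultimately show ?thesis by auto
  qed
  obtain x where x: "x > 0" "poly p x = 0" "p \<noteq> 0" using root[of p] assms by auto
  then obtain r where r: "p = [:-x, 1:] * r" by (metis dvdE poly_eq_0_iff_dvd)
  hence "r \<noteq> 0" using x by auto
  hence "proots p = {#x#} + proots r"
    unfolding r by (subst proots_mult) auto
  hence "size (filter_mset (\<lambda>x. x > 0) (proots r)) \<ge> 1" using assms x by simp
  then obtain y where y: "y > 0" "poly r y = 0" using root[of r] by auto
  then obtain q where "r = [:-y, 1:] * q" by (metis dvdE poly_eq_0_iff_dvd)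
  thus ?thesis using that x y r by blast
qed

text \<open>
  With two positive eigenvalues, a nonnegative determinant forces the third one to be nonnegative, and
  then the sum of the principal \<open>2 \<times> 2\<close> minors, being the second elementary symmetric function of the
  eigenvalues, would be positive.
\<close>

lemma num_pos_eigenvalues_le_1I:
  fixes A :: "real^3^3"
  assumes sym: "\<And>a b. A $ a $ b = A $ b $ a"
    and minors: "\<And>i j. i \<noteq> j \<Longrightarrow> A$i$i * A$j$j \<le> (A$i$j)\<^sup>2"
    and det: "A$1$1 * A$2$2 * A$3$3 + 2 * A$1$2 * A$1$3 * A$2$3
            - A$1$1 * (A$2$3)\<^sup>2 - A$2$2 * (A$1$3)\<^sup>2 - A$3$3 * (A$1$2)\<^sup>2 \<ge> 0"
  shows "num_pos_eigenvalues A \<le> 1"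
proof (rule ccontr)
  assume "\<not> num_pos_eigenvalues A \<le> 1"
  then obtain x y q where xy: "x > 0" "y > 0" and q: "charpoly A = [:-x, 1:] * ([:-y, 1:] * q)"
    using two_positive_roots_factor[of "charpoly A"] unfolding num_pos_eigenvalues_def by auto
  define D where "D = A$1$1 * A$2$2 * A$3$3 + 2 * A$1$2 * A$1$3 * A$2$3
            - A$1$1 * (A$2$3)\<^sup>2 - A$2$2 * (A$1$3)\<^sup>2 - A$3$3 * (A$1$2)\<^sup>2"
  define m where "m = (A$1$1 * A$2$2 - (A$1$2)\<^sup>2) + (A$1$1 * A$3$3 - (A$1$3)\<^sup>2)
            + (A$2$2 * A$3$3 - (A$2$3)\<^sup>2)"
  define t where "t = - (A$1$1 + A$2$2 + A$3$3)"
  have p: "charpoly A = [:-D, m, t, 1:]"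
    unfolding D_def m_def t_def by (rule charpoly_3[OF sym UNIV_3[symmetric]])
  have D: "D \<ge> 0" unfolding D_def by (rule det)
  have m: "m \<le> 0"
    using minors[of 1 2] minors[of 1 3] minors[of 2 3] unfolding m_def by simp
  have "q \<noteq> 0" using p q by auto
  have deg: "degree (charpoly A) = Suc (Suc (degree q))"
  proof -
    have "degree ([:-y, 1:] * q) = Suc (degree q)"
      using \<open>q \<noteq> 0\<close> by (subst degree_mult_eq) auto
    moreover have "[:-y, 1:] * q \<noteq> 0" using \<open>q \<noteq> 0\<close> by (metis mult_eq_0_iff one_neq_zero pCons_eq_0_iff)
    ultimately show ?thesis unfolding q by (subst degree_mult_eq) auto
  qed
  have "degree q = 1" using deg unfolding p by simp
  then obtain u v where quv: "q = [:u, v:]" by (metis degree1_coeffs)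
  have "v = 1" "-D = x * y * u" and mq: "m = x * y - u * (x + y)"
    using p unfolding q quv by (auto simp: algebra_simps)
  \<comment> \<open>the third root is \<open>-u\<close>\<close>
  have "u \<le> 0" using \<open>-D = x * y * u\<close> D xy
    by (smt (verit) mult_pos_pos)
  hence "u * (x + y) \<le> 0" using xy by (simp add: mult_nonpos_nonneg)
  moreover have "x * y > 0" using xy by simp
  ultimately show False using m mq by simp
qed

text \<open>
  This is Cauchy interlacing with the principal block on \<open>{i, j}\<close>. Its eigenvalues \<open>m < M\<close> are distinct
  because \<open>A\<^sub>i\<^sub>j \<noteq> 0\<close>, and the characteristic polynomial \<open>p\<close> of \<open>A\<close> satisfies \<open>p(M) \<le> 0 \<le> p(m)\<close>. With at
  most one positive root, \<open>p\<close> is negative on \<open>(0, M)\<close>, so \<open>m \<le> 0\<close>; this makes the minor \<open>M m\<close>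
  nonpositive, while \<open>p(0) \<le> 0\<close> is the statement on the determinant.
\<close>

lemma one_positive_eigenvalue_minor_det:
  fixes A :: "real^3^3"
  assumes sym: "\<And>a b. A $ a $ b = A $ b $ a" and ijk: "{i, j, k} = (UNIV :: 3 set)"
    and one: "num_pos_eigenvalues A \<le> 1"
    and nonneg: "A$i$i \<ge> 0" "A$i$j \<noteq> 0"
  shows "A$i$i * A$j$j \<le> (A$i$j)\<^sup>2"
    and "A$i$i * A$j$j * A$k$k + 2 * A$i$j * A$i$k * A$j$k
            - A$i$i * (A$j$k)\<^sup>2 - A$j$j * (A$i$k)\<^sup>2 - A$k$k * (A$i$j)\<^sup>2 \<ge> 0"
proof -
  define a b c u v s where defs: "a = A$i$i" "b = A$j$j" "c = A$i$j" "u = A$i$k" "v = A$j$k" "s = A$k$k"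
  define p where "p = charpoly A"
  have p: "p = [: - (a * b * s + 2 * c * u * v - a * v\<^sup>2 - b * u\<^sup>2 - s * c\<^sup>2),
       (a * b - c\<^sup>2) + (a * s - u\<^sup>2) + (b * s - v\<^sup>2), - (a + b + s), 1 :]"
    unfolding p_def defs by (rule charpoly_3[OF sym ijk])
  have monic: "lead_coeff p = 1" unfolding p by simp
  have roots: "size (filter_mset (\<lambda>x. x > 0) (proots p)) \<le> 1"
    using one unfolding num_pos_eigenvalues_def p_def .
  define h where "h = sqrt (((a - b) / 2)\<^sup>2 + c\<^sup>2)"
  have h2: "h\<^sup>2 = ((a - b) / 2)\<^sup>2 + c\<^sup>2" unfolding h_def by simp
  have c0: "c\<^sup>2 > 0" using nonneg defs by simp
  have "\<bar>(a - b) / 2\<bar> < h"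
    unfolding h_def by (rule real_less_rsqrt) (use c0 in \<open>simp only: power2_abs less_add_same_cancel1\<close>)
  hence h: "h > (a - b) / 2" "h > (b - a) / 2" by (simp_all add: abs_less_iff)
  define M m where Mm: "M = (a + b) / 2 + h" "m = (a + b) / 2 - h"
  have M: "M > a" "M > b" "m < a" "m < b" using h unfolding Mm by (simp_all add: field_simps)
  have ev: "(x - a) * (x - b) = c\<^sup>2" if "x = M \<or> x = m" for x
  proof -
    have "(x - a) * (x - b) = (x - (a + b) / 2)\<^sup>2 - ((a - b) / 2)\<^sup>2"
      by (simp add: field_simps power2_eq_square)
    also have "(x - (a + b) / 2)\<^sup>2 = h\<^sup>2"
    proof -
      from that have "x - (a + b) / 2 = h \<or> x - (a + b) / 2 = - h" unfolding Mm by argo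
      thus ?thesis by (metis power2_minus)
    qed
    finally show ?thesis using h2 by simp
  qed
  \<comment> \<open>at an eigenvalue of the block only the bordering terms of \<open>p\<close> remain, and they form a square\<close>
  have px: "(x - a) * poly p x = - (u * c + v * (x - a))\<^sup>2" if "x = M \<or> x = m" for x
  proof -
    have "(x - a) * poly p x = (x - a) * ((x - s) * ((x - a) * (x - b) - c\<^sup>2)) 
      - (u\<^sup>2 * ((x - a) * (x - b)) + 2 * c * u * v * (x - a) + v\<^sup>2 * (x - a)\<^sup>2)"
      unfolding p by (simp add: algebra_simps power2_eq_square)
    also have "\<dots> = - (u * c + v * (x - a))\<^sup>2"
      unfolding ev[OF that] power2_sum power_mult_distrib by (simp add: mult.commute)
    finally show ?thesis .
  qed
  have pM: "poly p M \<le> 0"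
  proof -
    have "(M - a) * poly p M \<le> 0" using px[of M] by simp
    thus ?thesis using M(1) mult_pos_pos[of "M - a" "poly p M"] by linarith
  qed
  have pm: "poly p m \<ge> 0"
  proof -
    have "(m - a) * poly p m \<le> 0" using px[of m] by simp
    thus ?thesis using M(3) mult_neg_neg[of "m - a" "poly p m"] by linarith
  qed
  have "M > 0" using M(1) nonneg defs by simp
  note neg = monic_one_positive_root_neg[OF monic roots \<open>M > 0\<close> pM]
  have "m \<le> 0"
  proof (rule ccontr)
    assume "\<not> m \<le> 0"
    with neg(1)[of m] M pm show False by simp
  qed
  moreover have "M * m = a * b - c\<^sup>2"
  proof -
    have "M * m = ((a + b) / 2)\<^sup>2 - h\<^sup>2"
      unfolding Mm by (simp add: algebra_simps power2_eq_square)
    thus ?thesis unfolding h2 by (simp add: field_simps power2_eq_square)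
  qed
  ultimately have "a * b \<le> c\<^sup>2"
    using \<open>M > 0\<close> mult_nonneg_nonpos[of M m] by simp
  thus "A$i$i * A$j$j \<le> (A$i$j)\<^sup>2" unfolding defs .
  have "a * b * s + 2 * c * u * v - a * v\<^sup>2 - b * u\<^sup>2 - s * c\<^sup>2 \<ge> 0"
    using neg(2) unfolding p by simp
  thus "A$i$i * A$j$j * A$k$k + 2 * A$i$j * A$i$k * A$j$k
            - A$i$i * (A$j$k)\<^sup>2 - A$j$j * (A$i$k)\<^sup>2 - A$k$k * (A$i$j)\<^sup>2 \<ge> 0"
    unfolding defs .
qed

text \<open>
  With \<open>a = A\<^sub>i\<^sub>i\<close>, \<open>c = A\<^sub>i\<^sub>j\<close>, \<open>u = A\<^sub>i\<^sub>k\<close> and \<open>v = A\<^sub>j\<^sub>k\<close>, Sylvester's identity writes \<open>a det A\<close> as the product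
  of the principal minors on \<open>{i, j}\<close> and \<open>{i, k}\<close> minus \<open>(a v - c u)\<^sup>2\<close>. The determinant is nonnegative,
  and the two minors lie in \<open>[-c\<^sup>2, 0]\<close> and \<open>[-u\<^sup>2, 0]\<close>, so \<open>|a v - c u| \<le> c u\<close>.
\<close>

lemma one_positive_eigenvalue_product_le:
  fixes A :: "real^3^3"
  assumes sym: "\<And>a b. A $ a $ b = A $ b $ a" and ijk: "{i, j, k} = (UNIV :: 3 set)"
    and one: "num_pos_eigenvalues A \<le> 1"
    and nonneg: "\<And>a b. A $ a $ b \<ge> 0" and pos: "A$i$j > 0" "A$i$k > 0"
  shows "A$i$i * A$j$k \<le> 2 * (A$i$j * A$i$k)"
proof -
  define a b c u v s where defs: "a = A$i$i" "b = A$j$j" "c = A$i$j" "u = A$i$k" "v = A$j$k" "s = A$k$k"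
  have ikj: "{i, k, j} = UNIV" using ijk by auto
  have nn: "a \<ge> 0" "b \<ge> 0" "c \<ge> 0" "u \<ge> 0" "v \<ge> 0" "s \<ge> 0" unfolding defs using nonneg by auto
  have ab: "a * b \<le> c\<^sup>2" 
    unfolding defs by (rule one_positive_eigenvalue_minor_det(1)[OF sym ijk one]) (use nonneg pos in auto)
  have as: "a * s \<le> u\<^sup>2" 
    unfolding defs by (rule one_positive_eigenvalue_minor_det(1)[OF sym ikj one]) (use nonneg pos in auto)
  have det: "a * b * s + 2 * c * u * v - a * v\<^sup>2 - b * u\<^sup>2 - s * c\<^sup>2 \<ge> 0"
    unfolding defs by (rule one_positive_eigenvalue_minor_det(2)[OF sym ijk one]) (use nonneg pos in auto)
  have "(c\<^sup>2 - a * b) * (u\<^sup>2 - a * s) - (a * v - c * u)\<^sup>2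
      = a * (a * b * s + 2 * c * u * v - a * v\<^sup>2 - b * u\<^sup>2 - s * c\<^sup>2)"
    by algebra
  hence "(a * v - c * u)\<^sup>2 \<le> (c\<^sup>2 - a * b) * (u\<^sup>2 - a * s)"
    using mult_nonneg_nonneg[OF nn(1) det] by linarith
  also have "\<dots> \<le> c\<^sup>2 * u\<^sup>2"
    using ab as mult_nonneg_nonneg[OF nn(1,2)] mult_nonneg_nonneg[OF nn(1,6)]
    by (intro mult_mono; linarith | simp)
  finally have "(a * v - c * u)\<^sup>2 \<le> (c * u)\<^sup>2" by (simp add: power_mult_distrib)
  hence "a * v - c * u \<le> c * u" by (rule power2_le_imp_le) (simp add: nn)
  hence "a * v \<le> 2 * (c * u)" by linarith
  thus ?thesis unfolding defs .
qed

section \<open>The Farkas lemma for finite families of functions\<close>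

definition pairing :: "'a set \<Rightarrow> ('a \<Rightarrow> real) \<Rightarrow> ('a \<Rightarrow> real) \<Rightarrow> real" where
  "pairing S u x = (\<Sum>s\<in>S. u s * x s)"

text \<open>
  An algebraic proof by induction on the family: if dropping a member \<open>g\<^sub>m\<close> loses the implication,
  there is a \<open>y\<close> with \<open>g\<^sub>m(y) = 1\<close>, \<open>w(y) > 0\<close> and all other members nonpositive at \<open>y\<close>. Composing
  all forms with the projection \<open>x \<mapsto> x - g\<^sub>m(x) y\<close> onto the kernel of \<open>g\<^sub>m\<close> removes \<open>g\<^sub>m\<close>,
  and undoing the projection in the combination supplied by the induction hypothesis gives \<open>g\<^sub>m\<close> a coefficient that is nonnegative by the
  signs at \<open>y\<close>.
\<close>

lemma farkas_finite_family:
  fixes g :: "'i \<Rightarrow> 'a \<Rightarrow> real"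
  assumes "finite I" and "finite S"
    and "\<And>x. (\<forall>i\<in>I. pairing S (g i) x \<le> 0) \<Longrightarrow> pairing S w x \<le> 0"
  shows "\<exists>a. (\<forall>i\<in>I. a i \<ge> 0) \<and> (\<forall>s\<in>S. w s = (\<Sum>i\<in>I. a i * g i s))"
  using assms(1,3) unfolding pairing_def
proof (induction I arbitrary: g w rule: finite_induct)
  case empty
  have "(\<Sum>s\<in>S. w s * w s) \<le> 0" using empty.prems[of w] by simp
  hence "(\<Sum>s\<in>S. w s * w s) = 0" by (meson antisym sum_nonneg zero_le_square)
  hence "\<forall>s\<in>S. w s = 0" using \<open>finite S\<close> by (simp add: sum_nonneg_eq_0_iff)
  thus ?case by auto
next
  case (insert m I)
  define ip where "ip u x = (\<Sum>s\<in>S. u s * x s)" for u x :: "'a \<Rightarrow> real"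
  have prem: "ip w x \<le> 0" if "ip (g m) x \<le> 0" "\<And>i. i \<in> I \<Longrightarrow> ip (g i) x \<le> 0" for x
    using insert.prems[of x] that unfolding ip_def by auto
  show ?case
  proof (cases "\<forall>x. (\<forall>i\<in>I. ip (g i) x \<le> 0) \<longrightarrow> ip w x \<le> 0")
    case True
    then obtain a where a: "\<forall>i\<in>I. a i \<ge> 0" "\<forall>s\<in>S. w s = (\<Sum>i\<in>I. a i * g i s)"
      using insert.IH[of g w] unfolding ip_def by auto
    have "\<forall>s\<in>S. w s = (\<Sum>i\<in>insert m I. (a(m := 0)) i * g i s)"
      using a insert.hyps by (auto intro!: sum.cong)
    moreover have "\<forall>i\<in>insert m I. (a(m := 0)) i \<ge> 0" using a by auto
    ultimately show ?thesis by blast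
  next
    case False
    then obtain z where z: "\<forall>i\<in>I. ip (g i) z \<le> 0" "ip w z > 0" by force
    have mz: "ip (g m) z > 0" using prem[of z] z by force
    define y where "y s = z s / ip (g m) z" for s
    have ipy: "ip u y = ip u z / ip (g m) z" for u
      unfolding ip_def[of u] y_def by (simp add: sum_divide_distrib)
    have y: "\<forall>i\<in>I. ip (g i) y \<le> 0" "ip w y > 0" "ip (g m) y = 1"
      using z mz by (auto simp: ipy divide_nonpos_pos)
    \<comment> \<open>the forms composed with the projection, see \<open>proj\<close>\<close>
    define g' where "g' i s = g i s - ip (g i) y * g m s" for i s
    define w' where "w' s = w s - ip w y * g m s" for s
    have proj: "(\<Sum>s\<in>S. (u s - ip u y * g m s) * x s) = ip u (\<lambda>s. x s - ip (g m) x * y s)" for u x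
    proof -
      have "(\<Sum>s\<in>S. (u s - ip u y * g m s) * x s) = ip u x - ip u y * ip (g m) x"
        unfolding ip_def[of u x] ip_def[of "g m" x]
        by (simp add: algebra_simps sum_subtractf sum_distrib_left)
      also have "\<dots> = ip u (\<lambda>s. x s - ip (g m) x * y s)"
        unfolding ip_def[of u x] ip_def[of u y] ip_def[of u "\<lambda>s. x s - ip (g m) x * y s"]
        by (simp add: algebra_simps sum_subtractf sum_distrib_left)
      finally show ?thesis .
    qed
    have "(\<Sum>s\<in>S. w' s * x s) \<le> 0" if x: "\<forall>i\<in>I. (\<Sum>s\<in>S. g' i s * x s) \<le> 0" for x
      unfolding w'_def proj
    proof (rule prem)
      have "ip (g m) (\<lambda>s. x s - ip (g m) x * y s) = ip (g m) x - ip (g m) x * ip (g m) y"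
        unfolding ip_def[of "g m" "\<lambda>s. x s - ip (g m) x * y s"] ip_def[of "g m" y]
        by (simp add: right_diff_distrib sum_subtractf sum_distrib_left mult.left_commute) (simp add: ip_def)
      thus "ip (g m) (\<lambda>s. x s - ip (g m) x * y s) \<le> 0" using y by simp
    qed (use x in \<open>auto simp: g'_def proj\<close>)
    then obtain a where a: "\<forall>i\<in>I. a i \<ge> 0" "\<forall>s\<in>S. w' s = (\<Sum>i\<in>I. a i * g' i s)"
      using insert.IH[of g' w'] by auto
    define b where "b = a(m := ip w y - (\<Sum>i\<in>I. a i * ip (g i) y))"
    have "(\<Sum>i\<in>I. a i * ip (g i) y) \<le> 0"
      using a y by (intro sum_nonpos) (simp add: mult_nonneg_nonpos)
    hence "\<forall>i\<in>insert m I. b i \<ge> 0" using a y by (auto simp: b_def)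
    moreover have "w s = (\<Sum>i\<in>insert m I. b i * g i s)" if "s \<in> S" for s
    proof -
      have "(\<Sum>i\<in>insert m I. b i * g i s)
          = (ip w y - (\<Sum>i\<in>I. a i * ip (g i) y)) * g m s + (\<Sum>i\<in>I. a i * g i s)"
        using insert.hyps by (auto simp: b_def intro!: sum.cong)
      also have "\<dots> = ip w y * g m s + (\<Sum>i\<in>I. a i * g' i s)"
        unfolding g'_def by (simp add: algebra_simps sum_subtractf sum_distrib_left)
      also have "(\<Sum>i\<in>I. a i * g' i s) = w' s" using a that by simp
      finally show ?thesis unfolding w'_def by simp
    qed
    ultimately show ?thesis by blast
  qed
qed

section \<open>Exchange in the local supports of an M-convex set\<close>

lemma finite_Delta: "finite (Delta d)"
proof (rule inj_on_finite)
  show "inj_on (\<lambda>\<alpha>. (\<alpha> $ 1, \<alpha> $ 2, \<alpha> $ 3)) (Delta d)"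
    by (auto simp: inj_on_def vec_eq_iff forall_3)
  show "(\<lambda>\<alpha>. (\<alpha> $ 1, \<alpha> $ 2, \<alpha> $ 3)) ` Delta d \<subseteq> {..d} \<times> {..d} \<times> {..d}"
    by (auto simp: Delta_def)
qed auto

lemma finite_M_convex: "M_convex d S \<Longrightarrow> finite S"
  using finite_Delta finite_subset unfolding M_convex_def by blast

lemma e_nth: "e i $ j = (if i = j then 1 else 0)"
  by (simp add: e_def axis_def)

lemma diff_e_fst: "(\<beta> + e a + e b) - e a = \<beta> + e b"
  and diff_e_snd: "(\<beta> + e a + e b) - e b = \<beta> + e a"
  by (simp_all add: vec_eq_iff)

lemma add_e_commute: "\<beta> + e a + e b = \<beta> + e b + e a"
  by (simp add: ac_simps)

lemma third_index:
  assumes "i \<noteq> (j :: 3)"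
  obtains k where "{i, j, k} = UNIV" "k \<noteq> i" "k \<noteq> j"
proof -
  have "card {i, j} \<noteq> CARD(3)" using assms by simp
  hence "{i, j} \<noteq> UNIV" by metis
  then obtain k where k: "k \<noteq> i" "k \<noteq> j" by blast
  have "card {i, j, k} = CARD(3)" using assms k by simp
  hence "{i, j, k} = UNIV" by (rule card_eq_UNIV_imp_eq_UNIV[rotated]) simp
  thus ?thesis using k that by blast
qed

lemma UNIV_3_distinct:
  assumes "{i, j, k} = (UNIV :: 3 set)"
  shows "i \<noteq> j" "i \<noteq> k" "j \<noteq> k"
  using UNIV_3_cases[OF assms] by auto

lemma M_convex_exchangeE:
  assumes "M_convex d S" "\<alpha> \<in> S" "\<beta> \<in> S" "\<alpha> $ i > \<beta> $ i"
  obtains j where "\<alpha> $ j < \<beta> $ j" "\<alpha> - e i + e j \<in> S" "\<beta> - e j + e i \<in> S"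
  using assms unfolding M_convex_def by blast

text \<open>
  Whenever the positive term \<open>A\<^sub>i\<^sub>i A\<^sub>j\<^sub>k\<close> of a generator is present in a Hessian, so is its negative term:
  the exchange at \<open>i\<close> can only use \<open>j\<close> or \<open>k\<close>, and either choice yields both points. The two
  lemmas that follow play the same role for \<open>A\<^sub>i\<^sub>i A\<^sub>j\<^sub>j\<close>.
\<close>

lemma M_convex_square_opposite:
  assumes S: "M_convex d S" and ijk: "{i, j, k} = (UNIV :: 3 set)"
    and mem: "\<beta> + e i + e i \<in> S" "\<beta> + e j + e k \<in> S"
  shows "\<beta> + e i + e j \<in> S" "\<beta> + e i + e k \<in> S"
proof -
  note d = UNIV_3_distinct[OF ijk]
  have "(\<beta> + e i + e i) $ i > (\<beta> + e j + e k) $ i" using d by (simp add: e_nth)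
  then obtain l where l: "(\<beta> + e i + e i) $ l < (\<beta> + e j + e k) $ l"
    "(\<beta> + e i + e i) - e i + e l \<in> S" "(\<beta> + e j + e k) - e l + e i \<in> S"
    using M_convex_exchangeE[OF S mem] by blast
  have "l = j \<or> l = k" using l(1) by (auto simp: e_nth split: if_splits)
  hence "\<beta> + e i + e j \<in> S \<and> \<beta> + e i + e k \<in> S"
    using l(2,3) unfolding diff_e_fst
    by (auto simp: diff_e_fst diff_e_snd add_e_commute[of \<beta> j i] add_e_commute[of \<beta> k i])
  thus "\<beta> + e i + e j \<in> S" "\<beta> + e i + e k \<in> S" by auto
qed

lemma M_convex_two_squares:
  assumes S: "M_convex d S" and ij: "i \<noteq> j"
    and mem: "\<beta> + e i + e i \<in> S" "\<beta> + e j + e j \<in> S"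
  shows "\<beta> + e i + e j \<in> S"
proof -
  have "(\<beta> + e i + e i) $ i > (\<beta> + e j + e j) $ i" using ij by (simp add: e_nth)
  then obtain l where l: "(\<beta> + e i + e i) $ l < (\<beta> + e j + e j) $ l"
    "(\<beta> + e i + e i) - e i + e l \<in> S"
    using M_convex_exchangeE[OF S mem] by blast
  have "l = j" using l(1) by (auto simp: e_nth split: if_splits)
  thus ?thesis using l(2) by (simp add: diff_e_fst)
qed

text \<open>
  If a local support contains \<open>ii\<close> and \<open>jj\<close>, this gives \<open>ik\<close> from \<open>jk\<close> and conversely, while \<open>kk\<close> would
  give \<open>ik\<close> by \<open>M_convex_two_squares\<close>. Hence the local support either is exactly
  \<open>{ii, ij, jj}\<close> or carries both generators
  \<open>\<epsilon>\<^sub>i\<^sub>i + \<epsilon>\<^sub>j\<^sub>k - \<epsilon>\<^sub>i\<^sub>j - \<epsilon>\<^sub>i\<^sub>k\<close> and \<open>\<epsilon>\<^sub>j\<^sub>j + \<epsilon>\<^sub>i\<^sub>k - \<epsilon>\<^sub>i\<^sub>j - \<epsilon>\<^sub>j\<^sub>k\<close>,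
  whose sum is \<open>\<epsilon>\<^sub>i\<^sub>i + \<epsilon>\<^sub>j\<^sub>j - 2 \<epsilon>\<^sub>i\<^sub>j\<close>; this is why that vector is a generator only in the first case.
\<close>

lemma M_convex_square_mixed:
  assumes S: "M_convex d S" and ijk: "{i, j, k} = (UNIV :: 3 set)"
    and mem: "\<beta> + e i + e k \<in> S" "\<beta> + e j + e j \<in> S"
  shows "\<beta> + e j + e k \<in> S"
proof -
  have "{j, i, k} = UNIV" using ijk by blast
  thus ?thesis using M_convex_square_opposite(2)[OF S _ mem(2,1)] by blast
qed

section \<open>Generators as linear forms\<close>

lemma S_loc_iff: "e a + e b \<in> S_loc S \<beta> \<longleftrightarrow> \<beta> + e a + e b \<in> S"
proof
  assume "\<beta> + e a + e b \<in> S"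
  thus "e a + e b \<in> S_loc S \<beta>" unfolding S_loc_def by blast
next
  assume "e a + e b \<in> S_loc S \<beta>"
  then obtain i j where "e a + e b = e i + e j" "\<beta> + e i + e j \<in> S" unfolding S_loc_def by blast
  thus "\<beta> + e a + e b \<in> S" by (simp add: add.assoc)
qed

lemma finite_S_loc: "finite (S_loc S \<beta>)"
proof (rule finite_subset)
  show "S_loc S \<beta> \<subseteq> (\<lambda>(i, j). e i + e j) ` UNIV" unfolding S_loc_def by auto
qed auto

lemma S_loc_add_mem: "\<gamma> \<in> S_loc S \<beta> \<Longrightarrow> \<beta> + \<gamma> \<in> S"
  unfolding S_loc_def by (auto simp: add.assoc)

lemma sum_eps: "finite T \<Longrightarrow> a \<in> T \<Longrightarrow> (\<Sum>\<gamma>\<in>T. eps a \<gamma> * y \<gamma>) = y a"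
  unfolding eps_def by (subst sum.remove[of _ a]) (auto intro!: sum.neutral)

lemma pairing_extend:
  assumes "finite S"
  shows "pairing S (extend S \<beta> g) x = (\<Sum>\<gamma>\<in>S_loc S \<beta>. g \<gamma> * x (\<beta> + \<gamma>))"
proof -
  have "pairing S (extend S \<beta> g) x
      = (\<Sum>\<gamma>\<in>S_loc S \<beta>. g \<gamma> * (\<Sum>\<alpha>\<in>S. eps (\<beta> + \<gamma>) \<alpha> * x \<alpha>))"
    unfolding pairing_def extend_def sum_distrib_right
    by (subst sum.swap) (simp add: sum_distrib_left mult.assoc)
  also have "\<dots> = (\<Sum>\<gamma>\<in>S_loc S \<beta>. g \<gamma> * x (\<beta> + \<gamma>))"
    by (intro sum.cong refl) (simp add: sum_eps assms S_loc_add_mem)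
  finally show ?thesis .
qed

lemma pairing_extend_square_opposite:
  assumes "finite S"
    and "{e i + e i, e j + e k, e i + e j, e i + e k} \<subseteq> S_loc S \<beta>"
  shows "pairing S (extend S \<beta>
      (\<lambda>\<gamma>. eps (e i + e i) \<gamma> + eps (e j + e k) \<gamma> - eps (e i + e j) \<gamma> - eps (e i + e k) \<gamma>)) x
    = x (\<beta> + e i + e i) + x (\<beta> + e j + e k) - x (\<beta> + e i + e j) - x (\<beta> + e i + e k)"
proof -
  have m: "e i + e i \<in> S_loc S \<beta>" "e j + e k \<in> S_loc S \<beta>"
    "e i + e j \<in> S_loc S \<beta>" "e i + e k \<in> S_loc S \<beta>"
    using assms(2) by auto
  note E = m[THEN sum_eps[OF finite_S_loc, of _ S \<beta> "\<lambda>\<gamma>. x (\<beta> + \<gamma>)"]]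
  show ?thesis
    unfolding pairing_extend[OF assms(1)]
    by (simp add: left_diff_distrib distrib_right sum.distrib sum_subtractf E)
      (simp add: add.assoc)
qed

lemma pairing_extend_two_squares:
  assumes "finite S"
    and "S_loc S \<beta> = {e i + e i, e i + e j, e j + e j}"
  shows "pairing S (extend S \<beta>
      (\<lambda>\<gamma>. eps (e i + e i) \<gamma> + eps (e j + e j) \<gamma> - 2 * eps (e i + e j) \<gamma>)) x
    = x (\<beta> + e i + e i) + x (\<beta> + e j + e j) - 2 * x (\<beta> + e i + e j)"
proof -
  have m: "e i + e i \<in> S_loc S \<beta>" "e i + e j \<in> S_loc S \<beta>" "e j + e j \<in> S_loc S \<beta>"
    using assms(2) by auto
  note E = m[THEN sum_eps[OF finite_S_loc, of _ S \<beta> "\<lambda>\<gamma>. x (\<beta> + \<gamma>)"]]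
  show ?thesis
    unfolding pairing_extend[OF assms(1)]
    by (simp add: left_diff_distrib distrib_right sum.distrib sum_subtractf mult.assoc
          sum_distrib_left[symmetric] E)
      (simp add: add.assoc)
qed

lemma finite_generators: "finite (generators d S)"
proof -
  have fin: "finite (local_generators T)" for T
  proof (rule finite_subset)
    show "local_generators T \<subseteq>
      (\<lambda>(i, j, k) \<gamma>. eps (e i + e i) \<gamma> + eps (e j + e k) \<gamma> - eps (e i + e j) \<gamma> - eps (e i + e k) \<gamma>) ` UNIV
      \<union> (\<lambda>(i, j) \<gamma>. eps (e i + e i) \<gamma> + eps (e j + e j) \<gamma> - 2 * eps (e i + e j) \<gamma>) ` UNIV"
      unfolding local_generators_def by (auto simp: image_iff) blast+
  qed auto
  have "generators d S = (\<Union>\<beta>\<in>Delta (d - 2). extend S \<beta> ` local_generators (S_loc S \<beta>))"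
    unfolding generators_def by blast
  thus ?thesis using fin finite_Delta by simp
qed

lemma generators_vanish: "g \<in> generators d S \<Longrightarrow> \<alpha> \<notin> S \<Longrightarrow> g \<alpha> = 0"
  unfolding generators_def extend_def eps_def
  by (auto simp: indicator_def intro!: sum.neutral dest: S_loc_add_mem)

section \<open>Boundedness of the generators\<close>

lemma hess_nth: "hess f \<beta> $ a $ b = ncoeff f (\<beta> + e a + e b)"
  by (simp add: hess_def)

lemma hess_sym: "hess f \<beta> $ a $ b = hess f \<beta> $ b $ a"
  by (simp add: hess_nth add_e_commute)

lemma mfact_pos: "mfact \<alpha> > 0"
  unfolding mfact_def by (intro prod_pos) auto

lemma ncoeff_Lor:
  assumes "f \<in> Lor d S"
  shows "\<alpha> \<in> S \<Longrightarrow> ncoeff f \<alpha> > 0" "ncoeff f \<alpha> \<ge> 0"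
proof -
  have nn: "Poly_Mapping.lookup f \<alpha> \<ge> 0" for \<alpha>
    using assms unfolding Lor_def lorentzian_def by auto
  thus "ncoeff f \<alpha> \<ge> 0"
    using mfact_pos[of \<alpha>] unfolding ncoeff_def by simp
  assume "\<alpha> \<in> S"
  hence "Poly_Mapping.lookup f \<alpha> \<noteq> 0"
    using assms unfolding Lor_def by (auto simp: in_keys_iff)
  with nn[of \<alpha>] show "ncoeff f \<alpha> > 0"
    using mfact_pos[of \<alpha>] unfolding ncoeff_def by simp
qed

lemma pairing_generator_ln_le:
  assumes fin: "finite S" and f: "f \<in> Lor d S" and g: "g \<in> generators d S"
  shows "pairing S g (\<lambda>\<alpha>. ln (ncoeff f \<alpha>)) \<le> ln 2"
proof -
  obtain \<beta> h where \<beta>: "\<beta> \<in> Delta (d - 2)" and h: "h \<in> local_generators (S_loc S \<beta>)"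
    and gh: "g = extend S \<beta> h"
    using g unfolding generators_def by blast
  have one: "num_pos_eigenvalues (hess f \<beta>) \<le> 1"
    using f \<beta> unfolding Lor_def lorentzian_def by auto
  have nn: "hess f \<beta> $ a $ b \<ge> 0" for a b
    using ncoeff_Lor(2)[OF f] by (simp add: hess_nth)
  define c where "c a b = ncoeff f (\<beta> + e a + e b)" for a b
  have pos: "c a b > 0" if "e a + e b \<in> S_loc S \<beta>" for a b
    using that ncoeff_Lor(1)[OF f] unfolding c_def by (simp add: S_loc_iff)
  show ?thesis
    using h unfolding local_generators_def
  proof (elim UnE CollectE exE conjE)
    fix i j k
    assume h_eq: "h = (\<lambda>\<gamma>. eps (e i + e i) \<gamma> + eps (e j + e k) \<gamma> - eps (e i + e j) \<gamma> - eps (e i + e k) \<gamma>)"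
      and ijk: "{i, j, k} = UNIV"
      and T: "{e i + e i, e j + e k, e i + e j, e i + e k} \<subseteq> S_loc S \<beta>"
    have p: "c i i > 0" "c j k > 0" "c i j > 0" "c i k > 0" using T pos by auto
    have "hess f \<beta> $ i $ j > 0" "hess f \<beta> $ i $ k > 0"
      using p(3,4) unfolding hess_nth c_def by auto
    hence "c i i * c j k \<le> 2 * (c i j * c i k)"
      using one_positive_eigenvalue_product_le[OF hess_sym ijk one nn]
      unfolding hess_nth c_def by blast
    moreover have "ln (c i i * c j k) = ln (c i i) + ln (c j k)"
      by (intro ln_mult_pos p)
    moreover have "ln (2 * (c i j * c i k)) = ln 2 + (ln (c i j) + ln (c i k))"
      using ln_mult_pos[OF _ mult_pos_pos[OF p(3,4)], of 2] ln_mult_pos[OF p(3,4)] by simp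
    ultimately have "ln (c i i) + ln (c j k) \<le> ln 2 + (ln (c i j) + ln (c i k))"
      using p by (metis ln_mono mult_pos_pos)
    thus ?thesis
      unfolding gh h_eq pairing_extend_square_opposite[OF fin T] c_def[symmetric] by linarith
  next
    fix i j
    assume h_eq: "h = (\<lambda>\<gamma>. eps (e i + e i) \<gamma> + eps (e j + e j) \<gamma> - 2 * eps (e i + e j) \<gamma>)"
      and ij: "i \<noteq> j" and T: "S_loc S \<beta> = {e i + e i, e i + e j, e j + e j}"
    have p: "c i i > 0" "c j j > 0" "c i j > 0" using T pos by auto
    obtain k where k: "{i, j, k} = UNIV" "k \<noteq> i" "k \<noteq> j" using third_index[OF ij] .
    have "hess f \<beta> $ i $ j \<noteq> 0" using p(3) unfolding hess_nth c_def by simp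
    hence "c i i * c j j \<le> (c i j)\<^sup>2"
      using one_positive_eigenvalue_minor_det(1)[OF hess_sym k(1) one nn]
      unfolding hess_nth c_def by blast
    moreover have "ln (c i i * c j j) = ln (c i i) + ln (c j j)"
      by (intro ln_mult_pos p)
    moreover have "ln ((c i j)\<^sup>2) = 2 * ln (c i j)"
      using p by (simp add: ln_realpow)
    ultimately have "ln (c i i) + ln (c j j) \<le> 2 * ln (c i j)"
      using p by (metis ln_mono mult_pos_pos)
    moreover have "0 \<le> ln (2 :: real)" by simp
    ultimately show ?thesis
      unfolding gh h_eq pairing_extend_two_squares[OF fin T] c_def[symmetric] by linarith
  qed
qed

lemma prod_powr_eq_exp_pairing:
  assumes "\<And>\<alpha>. \<alpha> \<in> S \<Longrightarrow> c \<alpha> > 0"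
  shows "(\<Prod>\<alpha>\<in>S. c \<alpha> powr w \<alpha>) = exp (pairing S w (\<lambda>\<alpha>. ln (c \<alpha>)))"
proof (cases "finite S")
  case True
  have "(\<Prod>\<alpha>\<in>S. c \<alpha> powr w \<alpha>) = (\<Prod>\<alpha>\<in>S. exp (w \<alpha> * ln (c \<alpha>)))"
    by (intro prod.cong refl) (use assms in \<open>fastforce simp: powr_def\<close>)
  thus ?thesis unfolding pairing_def exp_sum[OF True] .
qed (simp add: pairing_def)

lemma Cone_subset_BR:
  assumes "M_convex d S"
  shows "Cone (generators d S) \<subseteq> BR d S"
proof
  fix w assume "w \<in> Cone (generators d S)"
  then obtain F a where F: "finite F" "F \<subseteq> generators d S" "\<forall>g\<in>F. a g \<ge> 0"
    and w: "w = (\<lambda>\<alpha>. \<Sum>g\<in>F. a g * g \<alpha>)" unfolding Cone_def by blast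
  have "w \<alpha> = 0" if "\<alpha> \<notin> S" for \<alpha>
    unfolding w by (intro sum.neutral ballI) (use generators_vanish F that in auto)
  moreover have "(\<Prod>\<alpha>\<in>S. ncoeff f \<alpha> powr w \<alpha>) \<le> exp (\<Sum>g\<in>F. a g * ln 2)" if f: "f \<in> Lor d S" for f
  proof -
    have "pairing S w x = (\<Sum>g\<in>F. a g * pairing S g x)" for x
      unfolding pairing_def w sum_distrib_right sum_distrib_left
      by (subst sum.swap) (simp add: mult.assoc)
    moreover have "(\<Sum>g\<in>F. a g * pairing S g (\<lambda>\<alpha>. ln (ncoeff f \<alpha>))) \<le> (\<Sum>g\<in>F. a g * ln 2)"
      using F pairing_generator_ln_le[OF finite_M_convex[OF assms] f]
      by (intro sum_mono mult_left_mono) auto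
    ultimately show ?thesis
      by (subst prod_powr_eq_exp_pairing) (simp_all add: ncoeff_Lor(1)[OF f])
  qed
  ultimately show "w \<in> BR d S" unfolding BR_def by (auto intro!: bdd_aboveI2)
qed

section \<open>Lorentzian polynomials going to infinity\<close>

definition half_sq :: "mindex \<Rightarrow> real" where
  "half_sq \<alpha> = (\<Sum>i\<in>UNIV. (real (\<alpha> $ i))\<^sup>2) / 2"

lemma half_sq_add_e:
  "half_sq (\<beta> + e a + e b) = half_sq \<beta> + real (\<beta> $ a) + real (\<beta> $ b) + (if a = b then 2 else 1)"
  using exhaust_3[of a] exhaust_3[of b]
  by (elim disjE; simp add: half_sq_def sum_3 e_nth power2_eq_square field_simps)

text \<open>
  Subtracting \<open>half_sq\<close> lowers every generator by a fixed amount. The value \<open>1\<close> in the first equation matters: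
  it supplies the factor \<open>exp (-1) \<le> 1/2\<close> that the determinants need.
\<close>

lemma half_sq_second_difference:
  assumes "{i, j, k} = (UNIV :: 3 set)"
  shows "half_sq (\<beta> + e i + e i) + half_sq (\<beta> + e j + e k)
    - half_sq (\<beta> + e i + e j) - half_sq (\<beta> + e i + e k) = 1"
    "half_sq (\<beta> + e i + e i) + half_sq (\<beta> + e j + e j) - 2 * half_sq (\<beta> + e i + e j) = 2"
  using UNIV_3_distinct[OF assms] by (simp_all add: half_sq_add_e)

text \<open>
  For each Hessian, with entries \<open>c\<^sub>i\<^sub>j\<close>, the condition on \<open>x\<close> together with the correction \<open>half_sq\<close> gives
  \<open>c\<^sub>i\<^sub>i c\<^sub>j\<^sub>k \<le> c\<^sub>i\<^sub>j c\<^sub>i\<^sub>k / 2\<close> and \<open>c\<^sub>i\<^sub>i c\<^sub>j\<^sub>j \<le> c\<^sub>i\<^sub>j\<^sup>2\<close>. So the principal \<open>2 \<times> 2\<close> minors are nonpositive, and each of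
  the three negative terms \<open>c\<^sub>i\<^sub>i c\<^sub>j\<^sub>k\<^sup>2\<close> of the determinant is at most half of \<open>c\<^sub>1\<^sub>2 c\<^sub>1\<^sub>3 c\<^sub>2\<^sub>3\<close>, which occurs
  with coefficient \<open>2\<close>; hence \<open>num_pos_eigenvalues_le_1I\<close> applies.
\<close>

lemma Lor_if_generators_nonpos:
  assumes S: "M_convex d S"
    and x: "\<forall>g\<in>generators d S. pairing S g x \<le> 0"
  shows "\<exists>f\<in>Lor d S. \<forall>\<alpha>\<in>S. ncoeff f \<alpha> = exp (x \<alpha> - half_sq \<alpha>)"
proof -
  note fin = finite_M_convex[OF S]
  define y where "y \<alpha> = x \<alpha> - half_sq \<alpha>" for \<alpha>
  define f where "f = Abs_poly_mapping (\<lambda>\<alpha>. if \<alpha> \<in> S then exp (y \<alpha>) / mfact \<alpha> else 0)"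
  have lookup: "Poly_Mapping.lookup f = (\<lambda>\<alpha>. if \<alpha> \<in> S then exp (y \<alpha>) / mfact \<alpha> else 0)"
    unfolding f_def by (rule lookup_Abs_poly_mapping) (use fin in \<open>auto intro: finite_subset\<close>)
  have nc: "ncoeff f \<alpha> = (if \<alpha> \<in> S then exp (y \<alpha>) else 0)" for \<alpha>
    using mfact_pos[of \<alpha>] unfolding ncoeff_def lookup by simp
  have keys: "Poly_Mapping.keys f = S"
    using mfact_pos by (auto simp: in_keys_iff lookup less_imp_neq[symmetric] split: if_splits)
  have "num_pos_eigenvalues (hess f \<beta>) \<le> 1" if \<beta>: "\<beta> \<in> Delta (d - 2)" for \<beta>
  proof -
    define c where "c a b = ncoeff f (\<beta> + e a + e b)" for a b
    have nn: "c a b \<ge> 0" for a b unfolding c_def nc by simp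
    have gen: "extend S \<beta> g \<in> generators d S" if "g \<in> local_generators (S_loc S \<beta>)" for g
      using that \<beta> unfolding generators_def by blast
    \<comment> \<open>\<open>so\<close> and \<open>ts\<close> are the logarithms of the two inequalities between the entries\<close>
    have so: "y (\<beta> + e i + e i) + y (\<beta> + e j + e k) \<le> y (\<beta> + e i + e j) + y (\<beta> + e i + e k) - 1"
      if ijk: "{i, j, k} = UNIV" and m: "\<beta> + e i + e i \<in> S" "\<beta> + e j + e k \<in> S" for i j k
    proof -
      have T: "{e i + e i, e j + e k, e i + e j, e i + e k} \<subseteq> S_loc S \<beta>"
        using m M_convex_square_opposite[OF S ijk m] by (simp add: S_loc_iff)
      have "extend S \<beta> (\<lambda>\<gamma>. eps (e i + e i) \<gamma> + eps (e j + e k) \<gamma> - eps (e i + e j) \<gamma> - eps (e i + e k) \<gamma>)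
          \<in> generators d S"
        by (rule gen) (use ijk T in \<open>unfold local_generators_def, blast\<close>)
      with x have "x (\<beta> + e i + e i) + x (\<beta> + e j + e k) - x (\<beta> + e i + e j) - x (\<beta> + e i + e k) \<le> 0"
        unfolding pairing_extend_square_opposite[OF fin T, symmetric] by blast
      thus ?thesis using half_sq_second_difference(1)[OF ijk, of \<beta>] unfolding y_def by linarith
    qed
    have ts: "y (\<beta> + e i + e i) + y (\<beta> + e j + e j) \<le> 2 * y (\<beta> + e i + e j)"
      if ij: "i \<noteq> j" and m: "\<beta> + e i + e i \<in> S" "\<beta> + e j + e j \<in> S" for i j
    proof -
      obtain k where k: "{i, j, k} = UNIV" "k \<noteq> i" "k \<noteq> j" using third_index[OF ij] .
      have k': "{j, i, k} = UNIV" using k by auto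
      have mij: "\<beta> + e i + e j \<in> S" by (rule M_convex_two_squares[OF S ij m])
      show ?thesis
      proof (cases "\<beta> + e i + e k \<in> S \<or> \<beta> + e j + e k \<in> S")
        \<comment> \<open>the inequality is the sum of two instances of \<open>so\<close>\<close>
        case True
        hence "\<beta> + e i + e k \<in> S" "\<beta> + e j + e k \<in> S"
          using M_convex_square_mixed[OF S k(1) _ m(2)] M_convex_square_mixed[OF S k' _ m(1)] by auto
        hence "y (\<beta> + e i + e i) + y (\<beta> + e j + e k) \<le> y (\<beta> + e i + e j) + y (\<beta> + e i + e k) - 1"
          "y (\<beta> + e j + e j) + y (\<beta> + e i + e k) \<le> y (\<beta> + e j + e i) + y (\<beta> + e j + e k) - 1"
          using so[OF k(1) m(1)] so[OF k' m(2)] by auto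
        thus ?thesis by (simp add: add_e_commute[of _ j i])
      next
        case False
        hence no: "\<beta> + e i + e k \<notin> S" "\<beta> + e k + e i \<notin> S" "\<beta> + e j + e k \<notin> S" "\<beta> + e k + e j \<notin> S"
          using add_e_commute[of \<beta> k] by simp_all
        have kk: "\<beta> + e k + e k \<notin> S"
          using False M_convex_two_squares[OF S k(2)[symmetric] m(1)] by blast
        have "S_loc S \<beta> = {e i + e i, e i + e j, e j + e j}"
        proof
          show "{e i + e i, e i + e j, e j + e j} \<subseteq> S_loc S \<beta>" using m mij by (simp add: S_loc_iff)
          show "S_loc S \<beta> \<subseteq> {e i + e i, e i + e j, e j + e j}"
          proof
            fix \<gamma> assume "\<gamma> \<in> S_loc S \<beta>"
            then obtain a b where ab: "\<gamma> = e a + e b" "\<beta> + e a + e b \<in> S" unfolding S_loc_def by blast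
            have "a \<in> {i, j, k}" "b \<in> {i, j, k}" using k by auto
            thus "\<gamma> \<in> {e i + e i, e i + e j, e j + e j}"
              using ab no kk by (auto simp: add.commute[of "e j" "e i"])
          qed
        qed
        note T = this
        have "extend S \<beta> (\<lambda>\<gamma>. eps (e i + e i) \<gamma> + eps (e j + e j) \<gamma> - 2 * eps (e i + e j) \<gamma>)
            \<in> generators d S"
          by (rule gen) (use ij T in \<open>unfold local_generators_def, blast\<close>)
        with x have "x (\<beta> + e i + e i) + x (\<beta> + e j + e j) - 2 * x (\<beta> + e i + e j) \<le> 0"
          unfolding pairing_extend_two_squares[OF fin T, symmetric] by blast
        thus ?thesis using half_sq_second_difference(2)[OF k(1), of \<beta>] unfolding y_def by argo
      qed
    qed
    have minor: "c i i * c j j \<le> (c i j)\<^sup>2" if ij: "i \<noteq> j" for i j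
    proof (cases "\<beta> + e i + e i \<in> S \<and> \<beta> + e j + e j \<in> S")
      case True
      hence m: "\<beta> + e i + e j \<in> S" using M_convex_two_squares[OF S ij] by blast
      have "exp (y (\<beta> + e i + e i) + y (\<beta> + e j + e j)) \<le> exp (2 * y (\<beta> + e i + e j))"
        using ts[OF ij] True by simp
      thus ?thesis using True m by (simp add: c_def nc exp_add exp_double)
    next
      case False
      thus ?thesis by (auto simp: c_def nc)
    qed
    have opp: "c i i * c j k * c j k \<le> 1/2 * (c i j * c i k) * c j k" if ijk: "{i, j, k} = UNIV" for i j k
    proof (cases "\<beta> + e i + e i \<in> S \<and> \<beta> + e j + e k \<in> S")
      case True
      hence m: "\<beta> + e i + e j \<in> S" "\<beta> + e i + e k \<in> S"
        using M_convex_square_opposite[OF S ijk] by blast+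
      have half: "exp (- 1) \<le> (1/2 :: real)"
        using exp_ge_add_one_self[of 1] by (simp add: exp_minus field_simps)
      have "exp (y (\<beta> + e i + e i) + y (\<beta> + e j + e k)) \<le> exp (- 1 + (y (\<beta> + e i + e j) + y (\<beta> + e i + e k)))"
        using so[OF ijk] True by simp
      also have "\<dots> \<le> 1/2 * exp (y (\<beta> + e i + e j) + y (\<beta> + e i + e k))"
        unfolding exp_add[of "- 1"] by (intro mult_right_mono half) simp
      finally have "c i i * c j k \<le> 1/2 * (c i j * c i k)"
        using True m by (simp add: c_def nc exp_add)
      thus ?thesis by (rule mult_right_mono) (rule nn)
    next
      case False
      thus ?thesis using nn by (auto simp: c_def nc)
    qed
    show ?thesis
    proof (rule num_pos_eigenvalues_le_1I[OF hess_sym])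
      show "hess f \<beta> $ i $ i * hess f \<beta> $ j $ j \<le> (hess f \<beta> $ i $ j)\<^sup>2" if "i \<noteq> j" for i j
        using minor[OF that] unfolding c_def hess_nth .
      have s: "c 2 1 = c 1 2" "c 3 1 = c 1 3" "c 3 2 = c 2 3"
        unfolding c_def by (simp_all add: add_e_commute)
      have u: "{2, 1, 3} = (UNIV :: 3 set)" "{3, 1, 2} = (UNIV :: 3 set)"
        unfolding UNIV_3 by auto
      have "c 1 1 * c 2 2 * c 3 3 + 2 * c 1 2 * c 1 3 * c 2 3
          - c 1 1 * (c 2 3)\<^sup>2 - c 2 2 * (c 1 3)\<^sup>2 - c 3 3 * (c 1 2)\<^sup>2 \<ge> 0"
      proof -
        have p: "c 1 1 * (c 2 3)\<^sup>2 \<le> 1/2 * (c 1 2 * c 1 3 * c 2 3)"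
          "c 2 2 * (c 1 3)\<^sup>2 \<le> 1/2 * (c 1 2 * c 1 3 * c 2 3)"
          "c 3 3 * (c 1 2)\<^sup>2 \<le> 1/2 * (c 1 2 * c 1 3 * c 2 3)"
          using opp[of 1 2 3, OF UNIV_3[symmetric]] opp[of 2 1 3, OF u(1)] opp[of 3 1 2, OF u(2)]
          unfolding s by (simp_all add: power2_eq_square mult_ac)
        have "c 1 1 * c 2 2 * c 3 3 \<ge> 0" "c 1 2 * c 1 3 * c 2 3 \<ge> 0" by (simp_all add: nn)
        with p show ?thesis by linarith
      qed
      thus "0 \<le> hess f \<beta> $ 1 $ 1 * hess f \<beta> $ 2 $ 2 * hess f \<beta> $ 3 $ 3
          + 2 * hess f \<beta> $ 1 $ 2 * hess f \<beta> $ 1 $ 3 * hess f \<beta> $ 2 $ 3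
          - hess f \<beta> $ 1 $ 1 * (hess f \<beta> $ 2 $ 3)\<^sup>2 - hess f \<beta> $ 2 $ 2 * (hess f \<beta> $ 1 $ 3)\<^sup>2
          - hess f \<beta> $ 3 $ 3 * (hess f \<beta> $ 1 $ 2)\<^sup>2"
        unfolding c_def hess_nth .
    qed
  qed
  hence eig: "\<forall>\<beta>\<in>Delta (d - 2). num_pos_eigenvalues (hess f \<beta>) \<le> 1" by blast
  have "f \<in> Lor d S"
  proof -
    have "Poly_Mapping.lookup f \<alpha> \<ge> 0" for \<alpha>
      using mfact_pos[of \<alpha>] unfolding lookup by simp
    moreover have "S \<subseteq> Delta d" using S unfolding M_convex_def by blast
    ultimately show ?thesis
      using S eig unfolding Lor_def lorentzian_def mem_Collect_eq keys by blast
  qed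
  moreover have "\<forall>\<alpha>\<in>S. ncoeff f \<alpha> = exp (x \<alpha> - half_sq \<alpha>)"
    unfolding nc y_def by simp
  ultimately show ?thesis by blast
qed

text \<open>
  The conditions on \<open>x\<close> are invariant under scaling by \<open>t \<ge> 0\<close>, while the correction \<open>half_sq\<close> stays fixed.
  Along the resulting Lorentzian polynomials the logarithm of the monomial is affine in \<open>t\<close> with
  slope \<open>pairing S w x\<close>, and boundedness makes this slope nonpositive.
\<close>

lemma BR_subset_Cone:
  assumes S: "M_convex d S"
  shows "BR d S \<subseteq> Cone (generators d S)"
proof
  fix w assume w: "w \<in> BR d S"
  note fin = finite_M_convex[OF S]
  obtain B where B: "\<And>f. f \<in> Lor d S \<Longrightarrow> (\<Prod>\<alpha>\<in>S. ncoeff f \<alpha> powr w \<alpha>) \<le> B"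
    using w unfolding BR_def bdd_above_def by auto
  have nonpos: "pairing S w x \<le> 0" if x: "\<forall>g\<in>generators d S. pairing S g x \<le> 0" for x
  proof (rule ccontr)
    assume "\<not> pairing S w x \<le> 0"
    hence pos: "pairing S w x > 0" by simp
    have bound: "t * pairing S w x - pairing S w half_sq \<le> ln B" if t: "t \<ge> 0" for t
    proof -
      have scale: "pairing S u (\<lambda>\<alpha>. t * x \<alpha>) = t * pairing S u x" for u
        unfolding pairing_def by (simp add: sum_distrib_left mult.left_commute)
      have "\<forall>g\<in>generators d S. pairing S g (\<lambda>\<alpha>. t * x \<alpha>) \<le> 0"
        using x t unfolding scale by (simp add: mult_nonneg_nonpos)
      from Lor_if_generators_nonpos[OF S this] obtain f where f: "f \<in> Lor d S"
        and nc: "\<And>\<alpha>. \<alpha> \<in> S \<Longrightarrow> ncoeff f \<alpha> = exp (t * x \<alpha> - half_sq \<alpha>)" by blast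
      have "pairing S w (\<lambda>\<alpha>. ln (ncoeff f \<alpha>)) = pairing S w (\<lambda>\<alpha>. t * x \<alpha> - half_sq \<alpha>)"
        unfolding pairing_def by (intro sum.cong refl) (simp add: nc)
      also have "\<dots> = t * pairing S w x - pairing S w half_sq"
        unfolding scale[symmetric] unfolding pairing_def by (simp add: right_diff_distrib sum_subtractf)
      finally have "exp (t * pairing S w x - pairing S w half_sq) \<le> B"
        using B[OF f] by (simp add: prod_powr_eq_exp_pairing[OF ncoeff_Lor(1)[OF f]])
      moreover from this have "B > 0" using exp_gt_zero less_le_trans by blast
      ultimately show ?thesis by (simp only: ln_ge_iff)
    qed
    \<comment> \<open>large enough for \<open>bound\<close> to fail\<close>
    define t where "t = (\<bar>ln B\<bar> + \<bar>pairing S w half_sq\<bar> + 1) / pairing S w x"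
    have "t \<ge> 0" using pos unfolding t_def by simp
    moreover have "t * pairing S w x = \<bar>ln B\<bar> + \<bar>pairing S w half_sq\<bar> + 1"
      using pos unfolding t_def by simp
    ultimately show False using bound[of t] by linarith
  qed
  have "\<exists>a. (\<forall>g\<in>generators d S. a g \<ge> 0) \<and>
      (\<forall>\<alpha>\<in>S. w \<alpha> = (\<Sum>g\<in>generators d S. a g * g \<alpha>))"
    by (rule farkas_finite_family[OF finite_generators fin]) (rule nonpos)
  then obtain a where a: "\<forall>g\<in>generators d S. a g \<ge> 0"
    "\<forall>\<alpha>\<in>S. w \<alpha> = (\<Sum>g\<in>generators d S. a g * g \<alpha>)" by blast
  have "w = (\<lambda>\<alpha>. \<Sum>g\<in>generators d S. a g * g \<alpha>)"
  proof
    fix \<alpha>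
    show "w \<alpha> = (\<Sum>g\<in>generators d S. a g * g \<alpha>)"
    proof (cases "\<alpha> \<in> S")
      case False
      hence "w \<alpha> = 0" using w unfolding BR_def by blast
      thus ?thesis by (simp add: generators_vanish[OF _ False])
    qed (use a in blast)
  qed
  with a(1) finite_generators[of d S] show "w \<in> Cone (generators d S)"
    unfolding Cone_def mem_Collect_eq
    by (intro exI[of _ "generators d S"] exI[of _ a] conjI) auto
qed

theorem theorem1:
  fixes d :: nat and S :: "mindex set"
  assumes "d \<ge> 2" and "M_convex d S"
  shows "BR d S = Cone (generators d S)"
  using Cone_subset_BR[OF assms(2)] BR_subset_Cone[OF assms(2)] by (rule equalityI[rotated])

end
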